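(* Let $G$ be a finite connected simple graph with vertex set $V$ and automorphism group $\Gamma=\Gamma(G)$. Then \[ Z(G)=\sum_{M} Z(\Gamma_M(G)), \] where the sum runs over a complete set of representatives $M$ of the unlabeled imbeddings of $G$ (i.e. one map from each $\Gamma$-orbit of maps of $G$), $Z(G)$ is the imbedding sum of $G$, and $Z(\Gamma_M(G))$ is the cycle index of the map-automorphism group $\Gamma_M(G)$ acting on $V$.
   Context: For a vertex $v$, $N(v)$ is the set of vertices adjacent to $v$. A rotation at $v$ is a cyclic permutation $\rho_v:N(v)\to N(v)$ (a single cycle through all of $N(v)$). A rotation system is an indexed family $\rho=\{\rho_v\}_{v\in V}$ of rotations, and a map is a pair $M=(G,\rho)$; maps correspond to labeled 2-cell imbeddings of $G$ in oriented closed surfaces. The automorphism group $\Gamma(G)$ acts on maps: $\gamma\in\Gamma$ sends $(G,\rho)$ to $(G,\rho')$ with $\rho'_{\gamma(v)}=\gamma\rho_v\gamma^{-1}$ for all $v$. The map-automorphism group $\Gamma_M(G)$ is the stabilizer of $M$ under this action, and the $\Gamma$-orbits of maps are the unlabeled imbeddings of $G$. For $\gamma\in\Gamma$, $F(\gamma)$ denotes the set of maps fixed by $\gamma$. For a permutation $\gamma$ of $V$ let $s(\gamma)=\prod_k s_k^{j_k}$, where $j_k$ is the number of cycles of length $k$ of $\gamma$ on $V$ and $s_1,s_2,\dots$ are indeterminates. The imbedding sum is $Z(G)=\frac{1}{|\Gamma(G)|}\sum_{\gamma\in\Gamma(G)}|F(\gamma)|\,s(\gamma)$. For a permutation group $H$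 on $V$, its cycle index is $Z(H)=\frac{1}{|H|}\sum_{h\in H}s(h)$. *)

theory Defs
  imports
    "HOL-Algebra.Group_Action"
    "HOL-Combinatorics.Orbits"
    "HOL-Library.Poly_Mapping"
    "Graph_Theory.Graph_Theory"
begin

text \<open>
  \<^const>\<open>orbit\<close> exists twice: \<open>Orbits.orbit \<gamma> x\<close> is the cycle of the single permutation \<open>\<gamma>\<close>
  through \<open>x\<close>, while \<open>Group_Action.orbit\<close> is the orbit under a group.
\<close>

subsection \<open>Graph automorphisms and maps\<close>

definition nbhd :: "'a pair_pre_digraph \<Rightarrow> 'a \<Rightarrow> 'a set" where
  "nbhd G v = {w. (v, w) \<in> parcs G}"

definition graph_automorphism :: "'a pair_pre_digraph \<Rightarrow> ('a \<Rightarrow> 'a) \<Rightarrow> bool" where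
  "graph_automorphism G \<gamma> \<longleftrightarrow>
     \<gamma> permutes pverts G \<and>
     (\<forall>u\<in>pverts G. \<forall>v\<in>pverts G. (\<gamma> u, \<gamma> v) \<in> parcs G \<longleftrightarrow> (u, v) \<in> parcs G)"

definition aut_group :: "'a pair_pre_digraph \<Rightarrow> ('a \<Rightarrow> 'a) monoid" where
  "aut_group G = \<lparr>carrier = {\<gamma>. graph_automorphism G \<gamma>}, monoid.mult = (\<circ>), one = id\<rparr>"

text \<open>
  \<^const>\<open>cyclic_on\<close> is false on the empty set; the empty permutation at an isolated vertex is
  admitted as a rotation, so that the one-vertex graph has its (unique) map on the sphere.
\<close>

definition is_rotation :: "'a pair_pre_digraph \<Rightarrow> 'a \<Rightarrow> ('a \<Rightarrow> 'a) \<Rightarrow> bool" where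
  "is_rotation G v r \<longleftrightarrow> r permutes nbhd G v \<and> (nbhd G v \<noteq> {} \<longrightarrow> cyclic_on r (nbhd G v))"

definition rotation_systems :: "'a pair_pre_digraph \<Rightarrow> ('a \<Rightarrow> 'a \<Rightarrow> 'a) set" where
  "rotation_systems G = (\<Pi>\<^sub>E v\<in>pverts G. {r. is_rotation G v r})"

type_synonym 'a graph_map = "'a pair_pre_digraph \<times> ('a \<Rightarrow> 'a \<Rightarrow> 'a)"

definition maps :: "'a pair_pre_digraph \<Rightarrow> 'a graph_map set" where
  "maps G = {(G, \<rho>) | \<rho>. \<rho> \<in> rotation_systems G}"

text \<open>
  The defining equation \<open>\<rho>'(\<gamma> v) = \<gamma> \<circ> \<rho>(v) \<circ> \<gamma>\<^sup>-\<^sup>1\<close> is written with \<open>w = \<gamma> v\<close>.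
\<close>

definition map_action :: "'a pair_pre_digraph \<Rightarrow> ('a \<Rightarrow> 'a) \<Rightarrow> 'a graph_map \<Rightarrow> 'a graph_map" where
  "map_action G \<gamma> =
     (\<lambda>M\<in>maps G. (G, \<lambda>w\<in>pverts G. \<gamma> \<circ> snd M (inv_into UNIV \<gamma> w) \<circ> inv_into UNIV \<gamma>))"

definition map_automorphisms :: "'a pair_pre_digraph \<Rightarrow> 'a graph_map \<Rightarrow> ('a \<Rightarrow> 'a) set" where
  "map_automorphisms G M = stabilizer (aut_group G) (map_action G) M"

definition unlabeled_imbeddings :: "'a pair_pre_digraph \<Rightarrow> 'a graph_map set set" where
  "unlabeled_imbeddings G = orbits (aut_group G) (maps G) (map_action G)"

definition fixed_maps :: "'a pair_pre_digraph \<Rightarrow> ('a \<Rightarrow> 'a) \<Rightarrow> 'a graph_map set" where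
  "fixed_maps G \<gamma> = invariants (maps G) (map_action G) \<gamma>"

definition imbedding_representatives :: "'a pair_pre_digraph \<Rightarrow> 'a graph_map set \<Rightarrow> bool" where
  "imbedding_representatives G R \<longleftrightarrow>
     R \<subseteq> maps G \<and> (\<forall>X\<in>unlabeled_imbeddings G. \<exists>!M. M \<in> R \<and> M \<in> X)"

subsection \<open>Cycle index and imbedding sum\<close>

text \<open>
  Rational polynomials in indeterminates \<open>s\<^sub>k\<close>, \<open>k :: nat\<close> (\<open>s\<^sub>0\<close> is never used), as finitely
  supported functions from monomials (exponent vectors) to coefficients; multiplication on
  \<^type>\<open>poly_mapping\<close> is convolution.
\<close>

type_synonym cycle_poly = "(nat \<Rightarrow>\<^sub>0 nat) \<Rightarrow>\<^sub>0 rat"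

definition indet :: "nat \<Rightarrow> cycle_poly" where
  "indet k = Poly_Mapping.single (Poly_Mapping.single k 1) 1"

definition scale_poly :: "rat \<Rightarrow> cycle_poly \<Rightarrow> cycle_poly" where
  "scale_poly c p = Poly_Mapping.single 0 c * p"

definition num_cycles :: "'a set \<Rightarrow> ('a \<Rightarrow> 'a) \<Rightarrow> nat \<Rightarrow> nat" where
  "num_cycles V \<gamma> k = card {C \<in> Orbits.orbit \<gamma> ` V. card C = k}"

text \<open>
  No cycle on \<open>V\<close> is longer than \<open>card V\<close>, so the product over all \<open>k \<ge> 1\<close> may stop there.
\<close>

definition cycle_monomial :: "'a set \<Rightarrow> ('a \<Rightarrow> 'a) \<Rightarrow> cycle_poly" where
  "cycle_monomial V \<gamma> = (\<Prod>k=1..card V. indet k ^ num_cycles V \<gamma> k)"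

definition cycle_index :: "'a set \<Rightarrow> ('a \<Rightarrow> 'a) set \<Rightarrow> cycle_poly" where
  "cycle_index V H = scale_poly (1 / of_nat (card H)) (\<Sum>h\<in>H. cycle_monomial V h)"

definition imbedding_sum :: "'a pair_pre_digraph \<Rightarrow> cycle_poly" where
  "imbedding_sum G =
     scale_poly (1 / of_nat (order (aut_group G)))
       (\<Sum>\<gamma>\<in>carrier (aut_group G).
          scale_poly (of_nat (card (fixed_maps G \<gamma>))) (cycle_monomial (pverts G) \<gamma>))"

end

theory Submission
  imports Defs
begin

text \<open>
  This is Burnside's lemma with weights. Double counting the pairs of a map and an automorphism
  fixing it turns \<open>\<Sum>\<^sub>\<gamma> |F(\<gamma>)| s(\<gamma>)\<close> into the sum over all maps \<open>M\<close> of the \<open>s(\<gamma>)\<close>,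
  \<open>\<gamma>\<close> fixing \<open>M\<close>. As \<open>s\<close> is a class function and the stabilizers along an orbit are conjugate,
  the inner sum is constant on orbits, and an orbit has \<open>|\<Gamma>| / |\<Gamma>\<^sub>M|\<close> elements.
\<close>

section \<open>Weighted orbit counting for an arbitrary group action\<close>

text \<open>An action is by definition a homomorphism into \<open>BijGroup E\<close>, whose elements
  are extensional bijections multiplied by \<open>compose E\<close>. The pointwise laws suffice,
  because the action of the inverse element provides the two-sided inverse map on
  \<open>E\<close>.\<close>

lemma group_actionI:
  assumes "group A"
    and ext: "\<And>g. g \<in> carrier A \<Longrightarrow> \<phi> g \<in> extensional E"
    and closed: "\<And>g x. g \<in> carrier A \<Longrightarrow> x \<in> E \<Longrightarrow> \<phi> g x \<in> E"
    and one: "\<And>x. x \<in> E \<Longrightarrow> \<phi> \<one>\<^bsub>A\<^esub> x = x"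
    and mult: "\<And>g h x. g \<in> carrier A \<Longrightarrow> h \<in> carrier A \<Longrightarrow> x \<in> E \<Longrightarrow>
                 \<phi> (g \<otimes>\<^bsub>A\<^esub> h) x = \<phi> g (\<phi> h x)"
  shows "group_action A E \<phi>"
proof -
  interpret group A by fact
  have bij: "\<phi> g \<in> Bij E" if g: "g \<in> carrier A" for g
  proof -
    have "bij_betw (\<phi> g) E E"
    proof (rule bij_betwI[where g = "\<phi> (inv\<^bsub>A\<^esub> g)"])
      show "\<phi> g \<in> E \<rightarrow> E" "\<phi> (inv\<^bsub>A\<^esub> g) \<in> E \<rightarrow> E"
        using g closed by auto
      show "\<phi> (inv\<^bsub>A\<^esub> g) (\<phi> g x) = x" if "x \<in> E" for x
        using g that mult[of "inv\<^bsub>A\<^esub> g" g x] one by simp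
      show "\<phi> g (\<phi> (inv\<^bsub>A\<^esub> g) x) = x" if "x \<in> E" for x
        using g that mult[of g "inv\<^bsub>A\<^esub> g" x] one by simp
    qed
    with ext[OF g] show ?thesis by (simp add: Bij_def)
  qed
  have "\<phi> (g \<otimes>\<^bsub>A\<^esub> h) = compose E (\<phi> g) (\<phi> h)" if "g \<in> carrier A" "h \<in> carrier A" for g h
    using that by (intro extensionalityI[of _ E]) (auto simp: ext mult compose_eq)
  then have "\<phi> \<in> hom A (BijGroup E)"
    by (auto simp: hom_def BijGroup_def bij)
  then show ?thesis
    by (intro group_action.intro group_hom.intro group_hom_axioms.intro group_BijGroup) (rule assms(1))
qed

text \<open>Both sides add \<open>w g\<close> over the pairs \<open>(g, x)\<close> with
  \<open>\<phi> g x = x\<close>, grouped on the left by \<open>g\<close> and on the right by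
  \<open>x\<close>.\<close>

lemma (in group_action) sum_invariants_eq_sum_stabilizers:
  fixes w :: "'a \<Rightarrow> 'w::comm_semiring_1"
  assumes "finite (carrier G)" "finite E"
  shows "(\<Sum>g\<in>carrier G. of_nat (card (invariants E \<phi> g)) * w g) = (\<Sum>x\<in>E. \<Sum>g\<in>stabilizer G \<phi> x. w g)"
proof -
  have "(\<Sum>g\<in>carrier G. of_nat (card (invariants E \<phi> g)) * w g) =
      (\<Sum>g\<in>carrier G. \<Sum>x\<in>{x \<in> E. \<phi> g x = x}. w g)"
    by (simp add: invariants_def)
  also have "\<dots> = (\<Sum>x\<in>E. \<Sum>g\<in>{g \<in> carrier G. \<phi> g x = x}. w g)"
    by (rule sum.swap_restrict) (use assms in auto)
  finally show ?thesis by (simp add: stabilizer_def)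
qed

text \<open>If \<open>a\<close> carries \<open>x\<close> to \<open>y\<close>, conjugation by
  \<open>a\<close> is a bijection from the stabilizer of \<open>x\<close> onto that of
  \<open>y\<close>, and it preserves \<open>w\<close>. Conjugacy is expressed as
  \<open>k \<otimes> g = g \<otimes> h\<close>, which avoids the inverse, so that in a group of
  permutations it can be checked by composition alone.\<close>

lemma (in group_action) sum_stabilizer_orbit_eq:
  assumes "x \<in> E" "y \<in> Group_Action.orbit G \<phi> x"
    and class_fun: "\<And>g h k. \<lbrakk>g \<in> carrier G; h \<in> carrier G; k \<in> carrier G; k \<otimes> g = g \<otimes> h\<rbrakk> \<Longrightarrow> w k = w h"
  shows "(\<Sum>g\<in>stabilizer G \<phi> y. w g) = (\<Sum>g\<in>stabilizer G \<phi> x. w g)"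
proof -
  interpret group G
    using group_hom group_hom.axioms(1) by auto
  obtain a where a: "a \<in> carrier G" and y: "y = \<phi> a x"
    using assms(2) by (auto simp: Group_Action.orbit_def)
  have yE: "y \<in> E" and x: "\<phi> (inv a) y = x"
    using a y assms(1) element_image orbit_sym_aux by auto
  have cancel: "a \<otimes> (inv a \<otimes> z) = z" "inv a \<otimes> (a \<otimes> z) = z" if "z \<in> carrier G" for z
    using a that by (simp_all flip: m_assoc)
  show ?thesis
  proof (rule sum.reindex_bij_witness[where i = "\<lambda>h. a \<otimes> h \<otimes> inv a" and j = "\<lambda>k. inv a \<otimes> k \<otimes> a"])
    fix k assume "k \<in> stabilizer G \<phi> y"
    then have k: "k \<in> carrier G" "\<phi> k y = y" by (auto simp: stabilizer_def)
    then show "a \<otimes> (inv a \<otimes> k \<otimes> a) \<otimes> inv a = k"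
      using a by (simp add: m_assoc cancel)
    show "inv a \<otimes> k \<otimes> a \<in> stabilizer G \<phi> x"
      using a k x y yE assms(1) by (simp add: stabilizer_def composition_rule)
    show "w (inv a \<otimes> k \<otimes> a) = w k"
      using a k by (intro class_fun[symmetric, of a]) (auto simp flip: m_assoc)
  next
    fix h assume "h \<in> stabilizer G \<phi> x"
    then have h: "h \<in> carrier G" "\<phi> h x = x" by (auto simp: stabilizer_def)
    then show "inv a \<otimes> (a \<otimes> h \<otimes> inv a) \<otimes> a = h"
      using a by (simp add: m_assoc cancel)
    show "a \<otimes> h \<otimes> inv a \<in> stabilizer G \<phi> y"
      using a h x y yE assms(1) by (simp add: stabilizer_def composition_rule)
  qed
qed

text \<open>The sum over \<open>E\<close> of the stabilizer sums splits along the orbits and is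
  constant on each of them. Since \<open>R\<close> meets every orbit exactly once, the orbits can be
  indexed by \<open>R\<close>, and the constant is counted once for every point of the
  orbit.\<close>

lemma (in group_action) weighted_Burnside:
  fixes w :: "'a \<Rightarrow> 'w::comm_semiring_1"
  assumes fin: "finite (carrier G)" "finite E"
    and class_fun: "\<And>g h k. \<lbrakk>g \<in> carrier G; h \<in> carrier G; k \<in> carrier G; k \<otimes> g = g \<otimes> h\<rbrakk> \<Longrightarrow> w k = w h"
    and R: "R \<subseteq> E" "\<forall>X\<in>orbits G E \<phi>. \<exists>!x. x \<in> R \<and> x \<in> X"
  shows "(\<Sum>g\<in>carrier G. of_nat (card (invariants E \<phi> g)) * w g) =
    (\<Sum>x\<in>R. of_nat (card (Group_Action.orbit G \<phi> x)) * (\<Sum>g\<in>stabilizer G \<phi> x. w g))"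
proof -
  let ?W = "\<lambda>x. \<Sum>g\<in>stabilizer G \<phi> x. w g"
  have bij: "bij_betw (Group_Action.orbit G \<phi>) R (orbits G E \<phi>)"
    unfolding bij_betw_def
  proof
    show "inj_on (Group_Action.orbit G \<phi>) R"
    proof (rule inj_onI)
      fix x y assume xy: "x \<in> R" "y \<in> R" "Group_Action.orbit G \<phi> x = Group_Action.orbit G \<phi> y"
      then have "Group_Action.orbit G \<phi> x \<in> orbits G E \<phi>" "x \<in> Group_Action.orbit G \<phi> x" "y \<in> Group_Action.orbit G \<phi> x"
        using R(1) orbit_refl by (auto simp: orbits_def)
      then show "x = y" using R(2) xy by blast
    qed
    show "Group_Action.orbit G \<phi> ` R = orbits G E \<phi>"
    proof
      show "Group_Action.orbit G \<phi> ` R \<subseteq> orbits G E \<phi>"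
        using R(1) by (auto simp: orbits_def)
      show "orbits G E \<phi> \<subseteq> Group_Action.orbit G \<phi> ` R"
      proof
        fix X assume X: "X \<in> orbits G E \<phi>"
        then obtain x where x: "x \<in> R" "x \<in> X" using R(2) by blast
        then have "Group_Action.orbit G \<phi> x \<in> orbits G E \<phi>" "x \<in> Group_Action.orbit G \<phi> x"
          using R(1) orbit_refl by (auto simp: orbits_def)
        \<comment> \<open>Distinct orbits are disjoint, and these two share
          \<open>x\<close>.\<close>
        then have "X = Group_Action.orbit G \<phi> x"
          using disjoint_union[OF X] x by blast
        then show "X \<in> Group_Action.orbit G \<phi> ` R" using x by blast
      qed
    qed
  qed
  have "(\<Sum>g\<in>carrier G. of_nat (card (invariants E \<phi> g)) * w g) = (\<Sum>x\<in>E. ?W x)"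
    by (rule sum_invariants_eq_sum_stabilizers) fact+
  also have "\<dots> = (\<Sum>X\<in>orbits G E \<phi>. \<Sum>y\<in>X. ?W y)"
    using disjoint_sum[OF fin(2)] by metis
  also have "\<dots> = (\<Sum>x\<in>R. \<Sum>y\<in>Group_Action.orbit G \<phi> x. ?W y)"
    by (rule sum.reindex_bij_betw[OF bij, symmetric])
  also have "\<dots> = (\<Sum>x\<in>R. \<Sum>y\<in>Group_Action.orbit G \<phi> x. ?W x)"
    using R(1) by (intro sum.cong refl sum_stabilizer_orbit_eq class_fun) auto
  finally show ?thesis by simp
qed

section \<open>The automorphism group and its action on maps\<close>

lemma group_aut_group: "group (aut_group G)"
proof (rule groupI)
  fix \<gamma> \<delta> assume "\<gamma> \<in> carrier (aut_group G)" "\<delta> \<in> carrier (aut_group G)"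
  then show "\<gamma> \<otimes>\<^bsub>aut_group G\<^esub> \<delta> \<in> carrier (aut_group G)"
    by (auto simp: aut_group_def graph_automorphism_def permutes_compose permutes_in_image)
next
  fix \<gamma> assume "\<gamma> \<in> carrier (aut_group G)"
  then have \<gamma>: "graph_automorphism G \<gamma>" and p: "\<gamma> permutes pverts G"
    by (auto simp: aut_group_def graph_automorphism_def)
  have "graph_automorphism G (inv_into UNIV \<gamma>)"
    unfolding graph_automorphism_def
  proof (intro conjI ballI)
    show "inv_into UNIV \<gamma> permutes pverts G" by (rule permutes_inv[OF p])
    fix u v assume "u \<in> pverts G" "v \<in> pverts G"
    then have "inv_into UNIV \<gamma> u \<in> pverts G" "inv_into UNIV \<gamma> v \<in> pverts G"
      using permutes_in_image[OF permutes_inv[OF p]] by auto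
    \<comment> \<open>This is the equivalence for \<gamma> itself, read at the preimages of
      \<open>u\<close> and \<open>v\<close>.\<close>
    then show "(inv_into UNIV \<gamma> u, inv_into UNIV \<gamma> v) \<in> parcs G \<longleftrightarrow> (u, v) \<in> parcs G"
      using \<gamma> permutes_inverses(1)[OF p] by (metis graph_automorphism_def)
  qed
  then show "\<exists>\<delta>\<in>carrier (aut_group G). \<delta> \<otimes>\<^bsub>aut_group G\<^esub> \<gamma> = \<one>\<^bsub>aut_group G\<^esub>"
    using permutes_inv_o(2)[OF p] by (auto simp: aut_group_def)
qed (auto simp: aut_group_def graph_automorphism_def o_assoc)

lemma finite_aut_group:
  assumes "finite (pverts G)"
  shows "finite (carrier (aut_group G))"
  by (rule finite_subset[OF _ finite_permutations[OF assms]])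
     (auto simp: aut_group_def graph_automorphism_def)

text \<open>Automorphisms preserve arcs in both directions, which gives both inclusions.
  Well-formedness places every neighbour among the vertices, where it has a preimage under
  \<gamma>.\<close>

lemma nbhd_automorphism:
  assumes "pair_wf_digraph G" "graph_automorphism G \<gamma>" "v \<in> pverts G"
  shows "nbhd G (\<gamma> v) = \<gamma> ` nbhd G v"
proof -
  interpret pair_wf_digraph G by fact
  have p: "\<gamma> permutes pverts G"
    and arc: "\<And>u v. u \<in> pverts G \<Longrightarrow> v \<in> pverts G \<Longrightarrow> (\<gamma> u, \<gamma> v) \<in> parcs G \<longleftrightarrow> (u, v) \<in> parcs G"
    using assms(2) by (auto simp: graph_automorphism_def)
  show ?thesis
  proof (intro equalityI subsetI)
    fix w assume "w \<in> nbhd G (\<gamma> v)"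
    then have w: "(\<gamma> v, w) \<in> parcs G" "w \<in> pverts G" by (auto simp: nbhd_def dest: in_arcsD2)
    then obtain u where "u \<in> pverts G" "w = \<gamma> u" using permutes_image[OF p] by blast
    then show "w \<in> \<gamma> ` nbhd G v" using w arc assms(3) by (auto simp: nbhd_def)
  next
    fix w assume "w \<in> \<gamma> ` nbhd G v"
    then show "w \<in> nbhd G (\<gamma> v)" using arc assms(3) by (auto simp: nbhd_def dest: in_arcsD2)
  qed
qed

text \<open>Conjugation by \<gamma> relabels the entries of a cycle and so keeps it a single cycle.
  This is why the action on maps produces rotation systems again.\<close>

lemma is_rotation_conj:
  assumes "bij \<gamma>" "is_rotation G v r" "nbhd G w = \<gamma> ` nbhd G v"
  shows "is_rotation G w (\<gamma> \<circ> r \<circ> inv_into UNIV \<gamma>)"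
proof -
  have r: "r permutes nbhd G v" and cyc: "nbhd G v \<noteq> {} \<Longrightarrow> cyclic_on r (nbhd G v)"
    using assms(2) by (auto simp: is_rotation_def)
  have inv: "inv_into UNIV \<gamma> (\<gamma> x) = x" "\<gamma> (inv_into UNIV \<gamma> x) = x" for x
    using assms(1) by (auto simp: bij_is_inj bij_is_surj surj_f_inv_f)
  have "(\<gamma> \<circ> r \<circ> inv_into UNIV \<gamma>) permutes \<gamma> ` nbhd G v"
  proof (rule bij_imp_permutes)
    have "bij_betw \<gamma> (nbhd G v) (\<gamma> ` nbhd G v)"
      using assms(1) by (auto simp: bij_betw_def intro: inj_on_subset)
    moreover have "bij_betw (inv_into UNIV \<gamma>) (\<gamma> ` nbhd G v) (nbhd G v)"
      by (rule bij_betwI[where g = \<gamma>]) (auto simp: inv)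
    ultimately show "bij_betw (\<gamma> \<circ> r \<circ> inv_into UNIV \<gamma>) (\<gamma> ` nbhd G v) (\<gamma> ` nbhd G v)"
      using permutes_imp_bij[OF r] by (blast intro: bij_betw_trans)
  next
    fix x assume "x \<notin> \<gamma> ` nbhd G v"
    then have "inv_into UNIV \<gamma> x \<notin> nbhd G v" using inv(2) by (metis imageI)
    then show "(\<gamma> \<circ> r \<circ> inv_into UNIV \<gamma>) x = x"
      using permutes_not_in[OF r] inv by simp
  qed
  moreover have "cyclic_on (\<gamma> \<circ> r \<circ> inv_into UNIV \<gamma>) (\<gamma> ` nbhd G v)" if "nbhd G v \<noteq> {}"
    using cyc[OF that] by (rule cyclic_on_image) (simp add: inv)
  \<comment> \<open>The image of a neighbourhood is empty only if the neighbourhood is, so the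
    isolated case matches on both sides.\<close>
  ultimately show ?thesis by (simp add: is_rotation_def assms(3))
qed

lemma group_action_map_action:
  assumes "pair_wf_digraph G"
  shows "group_action (aut_group G) (maps G) (map_action G)"
proof (rule group_actionI[OF group_aut_group])
  show closed: "map_action G \<gamma> M \<in> maps G"
    if "\<gamma> \<in> carrier (aut_group G)" and M: "M \<in> maps G" for \<gamma> M
  proof -
    have \<gamma>: "graph_automorphism G \<gamma>" and p: "\<gamma> permutes pverts G"
      using that(1) by (auto simp: aut_group_def graph_automorphism_def)
    have "is_rotation G w (\<gamma> \<circ> snd M (inv_into UNIV \<gamma> w) \<circ> inv_into UNIV \<gamma>)"
      if w: "w \<in> pverts G" for w
    proof (rule is_rotation_conj[OF permutes_bij[OF p]])
      have v: "inv_into UNIV \<gamma> w \<in> pverts G"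
        using permutes_in_image[OF permutes_inv[OF p]] w by simp
      then show "is_rotation G (inv_into UNIV \<gamma> w) (snd M (inv_into UNIV \<gamma> w))"
        using M by (auto simp: maps_def rotation_systems_def)
      show "nbhd G w = \<gamma> ` nbhd G (inv_into UNIV \<gamma> w)"
        using nbhd_automorphism[OF assms \<gamma> v] permutes_inverses(1)[OF p] by simp
    qed
    with M show ?thesis
      by (auto simp: map_action_def maps_def rotation_systems_def)
  qed
  \<comment> \<open>A rotation system is extensional on the vertices, so restricting it to them
    changes nothing.\<close>
  show "map_action G \<one>\<^bsub>aut_group G\<^esub> M = M" if "M \<in> maps G" for M
    using that by (auto simp: map_action_def aut_group_def maps_def rotation_systems_def
        simp flip: id_def dest: PiE_restrict)
  show "map_action G \<gamma> \<in> extensional (maps G)" for \<gamma>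
    by (simp add: map_action_def)
  show "map_action G (\<gamma> \<otimes>\<^bsub>aut_group G\<^esub> \<delta>) M = map_action G \<gamma> (map_action G \<delta> M)"
    if \<gamma>: "\<gamma> \<in> carrier (aut_group G)" and \<delta>: "\<delta> \<in> carrier (aut_group G)" and M: "M \<in> maps G" for \<gamma> \<delta> M
  proof -
    have p: "\<gamma> permutes pverts G" "\<delta> permutes pverts G"
      using \<gamma> \<delta> by (auto simp: aut_group_def graph_automorphism_def)
    have act: "map_action G \<beta> L = (G, \<lambda>w\<in>pverts G. \<beta> \<circ> snd L (inv_into UNIV \<beta> w) \<circ> inv_into UNIV \<beta>)"
      if "L \<in> maps G" for \<beta> L
      using that by (simp add: map_action_def)
    have "inv_into UNIV (\<gamma> \<circ> \<delta>) = inv_into UNIV \<delta> \<circ> inv_into UNIV \<gamma>"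
      using p by (simp add: o_inv_distrib permutes_bij)
    \<comment> \<open>The inner restricted function is thus evaluated only at vertices, where it
      equals its defining expression.\<close>
    moreover have "inv_into UNIV \<gamma> w \<in> pverts G" if "w \<in> pverts G" for w
      using permutes_in_image[OF permutes_inv[OF p(1)]] that by simp
    ultimately show ?thesis
      using M by (subst act[OF closed[OF \<delta> M]]) (simp add: act aut_group_def o_assoc cong: restrict_cong)
  qed
qed

lemma finite_maps:
  assumes "pair_fin_digraph G"
  shows "finite (maps G)"
proof -
  interpret pair_fin_digraph G by fact
  have "finite {r. is_rotation G v r}" for v
  proof (rule finite_subset)
    have "nbhd G v \<subseteq> pverts G" by (auto simp: nbhd_def dest: in_arcsD2)
    then show "finite {r. r permutes nbhd G v}"
      using finite_permutations finite_subset pair_finite_verts by metis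
  qed (auto simp: is_rotation_def)
  then have "finite (rotation_systems G)"
    unfolding rotation_systems_def by (intro finite_PiE pair_finite_verts)
  then show ?thesis by (simp add: maps_def)
qed

section \<open>Cycle monomials and scalar multiples\<close>

text \<open>The injection \<gamma> carries the cycle of \<delta> through \<open>x\<close> onto the
  cycle of \<open>\<delta>'\<close> through \<open>\<gamma> x\<close>, so cycles correspond one to
  one with equal lengths. Hence the cycle monomial is a class function.\<close>

lemma num_cycles_conj:
  assumes V: "finite V" and \<gamma>: "\<gamma> permutes V" and \<delta>: "\<delta> permutes V" and conj: "\<delta>' \<circ> \<gamma> = \<gamma> \<circ> \<delta>"
  shows "num_cycles V \<delta>' k = num_cycles V \<delta> k"
proof -
  have inj: "inj \<gamma>" using \<gamma> by (rule permutes_inj)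
  \<comment> \<open>\<open>Orbits.orbit\<close> starts from the first iterate, so it contains its
    base point only when the point recurs; \<delta> permuting a finite set ensures this.\<close>
  have orbit: "Orbits.orbit \<delta>' (\<gamma> x) = \<gamma> ` Orbits.orbit \<delta> x" for x
    using V \<delta> conj by (intro orbit_inverse[symmetric] permutation_self_in_orbit)
      (auto simp: permutation_permutes fun_eq_iff)
  have "Orbits.orbit \<delta>' ` V = Orbits.orbit \<delta>' ` \<gamma> ` V" using permutes_image[OF \<gamma>] by simp
  also have "\<dots> = (`) \<gamma> ` Orbits.orbit \<delta> ` V" by (simp add: image_image orbit)
  finally have "{C \<in> Orbits.orbit \<delta>' ` V. card C = k} = (`) \<gamma> ` {C \<in> Orbits.orbit \<delta> ` V. card C = k}"
    using inj by (auto simp: card_image inj_on_subset)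
  moreover have "inj_on ((`) \<gamma>) X" for X
    using inj by (auto simp: inj_on_def inj_image_eq_iff)
  ultimately show ?thesis by (simp add: num_cycles_def card_image)
qed

text \<open>These rules pass between rational scalars and the \<open>of_nat\<close> factors that
  occur in the orbit count over a semiring.\<close>

lemma scale_poly_simps:
  "scale_poly (of_nat n) p = of_nat n * p"
  "scale_poly c (of_nat n * p) = scale_poly (c * of_nat n) p"
  "scale_poly c (sum f X) = (\<Sum>x\<in>X. scale_poly c (f x))"
proof -
  show "scale_poly (of_nat n) p = of_nat n * p"
    by (simp add: scale_poly_def)
  show "scale_poly c (of_nat n * p) = scale_poly (c * of_nat n) p"
    by (simp add: scale_poly_def mult_single mult.assoc flip: single_of_nat)
  show "scale_poly c (sum f X) = (\<Sum>x\<in>X. scale_poly c (f x))"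
    by (simp add: scale_poly_def sum_distrib_left)
qed

section \<open>The imbedding sum as a sum of cycle indices\<close>

theorem theorem5:
  fixes G :: "'a pair_pre_digraph" and R :: "'a graph_map set"
  assumes "pair_graph G"
    and "connected (with_proj G)"
    and "imbedding_representatives G R"
  shows "imbedding_sum G = (\<Sum>M\<in>R. cycle_index (pverts G) (map_automorphisms G M))"
proof -
  interpret pair_graph G by fact
  let ?A = "aut_group G"
  interpret group_action ?A "maps G" "map_action G"
    by (rule group_action_map_action) unfold_locales
  let ?s = "cycle_monomial (pverts G)"
  have fin: "finite (carrier ?A)" by (rule finite_aut_group[OF pair_finite_verts])
  have R: "R \<subseteq> maps G" "\<forall>X\<in>orbits ?A (maps G) (map_action G). \<exists>!M. M \<in> R \<and> M \<in> X"
    using assms(3) by (auto simp: imbedding_representatives_def unlabeled_imbeddings_def)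
  have class_fun: "?s \<delta>' = ?s \<delta>"
    if "\<gamma> \<in> carrier ?A" "\<delta> \<in> carrier ?A" "\<delta>' \<in> carrier ?A" "\<delta>' \<otimes>\<^bsub>?A\<^esub> \<gamma> = \<gamma> \<otimes>\<^bsub>?A\<^esub> \<delta>" for \<gamma> \<delta> \<delta>'
    using that num_cycles_conj[OF pair_finite_verts, of \<gamma> \<delta> \<delta>']
    by (simp add: cycle_monomial_def aut_group_def graph_automorphism_def)
  \<comment> \<open>The weighted orbit count is applied to the action on maps, with the cycle
    monomial as weight.\<close>
  have "imbedding_sum G = scale_poly (1 / of_nat (order ?A))
      (\<Sum>M\<in>R. of_nat (card (Group_Action.orbit ?A (map_action G) M)) *
        (\<Sum>\<gamma>\<in>map_automorphisms G M. ?s \<gamma>))"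
    unfolding imbedding_sum_def fixed_maps_def scale_poly_simps(1) map_automorphisms_def
    by (subst weighted_Burnside[OF fin finite_maps class_fun R]) auto
  also have "\<dots> = (\<Sum>M\<in>R. scale_poly (1 / of_nat (order ?A) *
      of_nat (card (Group_Action.orbit ?A (map_action G) M))) (\<Sum>\<gamma>\<in>map_automorphisms G M. ?s \<gamma>))"
    by (simp only: scale_poly_simps(2,3))
  also have "\<dots> = (\<Sum>M\<in>R. cycle_index (pverts G) (map_automorphisms G M))"
    unfolding cycle_index_def
  proof (rule sum.cong[OF refl])
    \<comment> \<open>By the orbit-stabilizer theorem, orbit size over group order is the reciprocal
      of the stabilizer size, which is the normalizing factor of the cycle index.\<close>
    fix M assume "M \<in> R"
    then have "of_nat (card (Group_Action.orbit ?A (map_action G) M)) *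
        of_nat (card (map_automorphisms G M)) = (of_nat (order ?A) :: rat)"
      using orbit_stabilizer_theorem[of M] R(1)
      by (auto simp: map_automorphisms_def simp flip: of_nat_mult)
    \<comment> \<open>The carrier is finite and contains the identity. A nonzero product also forces
      the stabilizer size to be nonzero, so both divisions are legitimate.\<close>
    moreover have "order ?A \<noteq> 0"
      using fin group_aut_group[of G] by (auto simp: order_def dest: group.is_monoid monoid.one_closed)
    ultimately have "1 / of_nat (order ?A) * of_nat (card (Group_Action.orbit ?A (map_action G) M)) =
        (1 / of_nat (card (map_automorphisms G M)) :: rat)"
      by (auto simp: divide_simps)
    then show "scale_poly (1 / of_nat (order ?A) *
          of_nat (card (Group_Action.orbit ?A (map_action G) M))) (\<Sum>\<gamma>\<in>map_automorphisms G M. ?s \<gamma>) =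
        scale_poly (1 / of_nat (card (map_automorphisms G M))) (\<Sum>\<gamma>\<in>map_automorphisms G M. ?s \<gamma>)"
      by simp
  qed
  finally show ?thesis .
qed

end
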